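(* Let $f\colon (G_1,K_1,H_1,E_1)\to(G_2,K_2,H_2,E_2)$ be a morphism of trifactorised groups. Then $\mathsf{B}(f)=f|_{K_1}\colon K_1\to K_2$ is a brace homomorphism from $\mathsf{B}(G_1,K_1,H_1,E_1)$ to $\mathsf{B}(G_2,K_2,H_2,E_2)$.
   Context: A skew left brace $(B,+,\cdot)$ is a set with two group operations ($+$ not necessarily commutative) such that $a(b+c)=ab-a+ac$ for all $a,b,c\in B$. A brace homomorphism is a map preserving both operations. A trifactorised group is a tuple $(G,K,H,E)$ with $G$ a group, $K\trianglelefteq G$, $H,E\le G$, $G=KE=KH=HE$ and $K\cap E=H\cap E=1$. A morphism $(G_1,K_1,H_1,E_1)\to(G_2,K_2,H_2,E_2)$ is a group homomorphism $f\colon G_1\to G_2$ with $f(K_1)\le K_2$, $f(H_1)\le H_2$, $f(E_1)\le E_2$. The associated brace $\mathsf{B}(G,K,H,E)$ is $(K,\cdot,\boxdot)$: its underlying set is $K$, its additive operation is the group operation of $K$ inherited from $G$, and its multiplicative operation is $k_1\boxdot k_2=k_1\,(e_{k_1}k_2e_{k_1}^{-1})$, where for $k\in K$, $e_k$ is the unique element of $E$ with $ke_k\in H$. This is a skew left brace. *)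

theory Defs
  imports "HOL-Algebra.Algebra"
begin

text \<open>
  A skew left brace is carried by the library record for structures with two operations:
  \<open>\<oplus>\<close> is the additive operation, which need not be commutative, and \<open>\<otimes>\<close> the multiplicative one.
  The record has separate fields \<open>\<zero>\<close> and \<open>\<one>\<close>; in a skew left brace they coincide.
\<close>

locale skew_left_brace =
  fixes B (structure)
  assumes additive_group: "group (add_monoid B)"
    and multiplicative_group: "group B"
    and brace_distrib:
      "\<lbrakk>a \<in> carrier B; b \<in> carrier B; c \<in> carrier B\<rbrakk>
        \<Longrightarrow> a \<otimes> (b \<oplus> c) = ((a \<otimes> b) \<ominus> a) \<oplus> (a \<otimes> c)"

locale skew_left_brace_hom =
  B: skew_left_brace B + C: skew_left_brace C for B (structure) and C (structure) +
  fixes h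
  assumes hom_closed: "h \<in> carrier B \<rightarrow> carrier C"
    and hom_add: "\<lbrakk>a \<in> carrier B; b \<in> carrier B\<rbrakk> \<Longrightarrow> h (a \<oplus>\<^bsub>B\<^esub> b) = h a \<oplus>\<^bsub>C\<^esub> h b"
    and hom_mult: "\<lbrakk>a \<in> carrier B; b \<in> carrier B\<rbrakk> \<Longrightarrow> h (a \<otimes>\<^bsub>B\<^esub> b) = h a \<otimes>\<^bsub>C\<^esub> h b"

locale trifactorised_group =
  group G + K: normal K G + H: subgroup H G + E: subgroup E G
  for G (structure) and K and H and E +
  assumes factor_KE: "carrier G = K <#> E"
    and factor_KH: "carrier G = K <#> H"
    and factor_HE: "carrier G = H <#> E"
    and K_inter_E: "K \<inter> E = {\<one>}"
    and H_inter_E: "H \<inter> E = {\<one>}"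

locale trifactorised_group_hom =
  source: trifactorised_group G1 K1 H1 E1 + target: trifactorised_group G2 K2 H2 E2
  for G1 (structure) and K1 and H1 and E1
    and G2 (structure) and K2 and H2 and E2 +
  fixes f
  assumes hom: "f \<in> hom G1 G2"
    and image_K: "f ` K1 \<subseteq> K2"
    and image_H: "f ` H1 \<subseteq> H2"
    and image_E: "f ` E1 \<subseteq> E2"

definition brace_elt :: "('a, 'm) monoid_scheme \<Rightarrow> 'a set \<Rightarrow> 'a set \<Rightarrow> 'a \<Rightarrow> 'a"
  where "brace_elt G H E k = (THE e. e \<in> E \<and> k \<otimes>\<^bsub>G\<^esub> e \<in> H)"

definition associated_brace ::
    "('a, 'm) monoid_scheme \<Rightarrow> 'a set \<Rightarrow> 'a set \<Rightarrow> 'a set \<Rightarrow> 'a ring"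
  where "associated_brace G K H E =
    \<lparr> carrier = K,
      monoid.mult = (\<lambda>k1 k2. k1 \<otimes>\<^bsub>G\<^esub>
        (brace_elt G H E k1 \<otimes>\<^bsub>G\<^esub> k2 \<otimes>\<^bsub>G\<^esub> inv\<^bsub>G\<^esub> (brace_elt G H E k1))),
      one = \<one>\<^bsub>G\<^esub>,
      ring.zero = \<one>\<^bsub>G\<^esub>,
      ring.add = (\<otimes>\<^bsub>G\<^esub>) \<rparr>"

end

theory Submission
  imports Defs
begin

text \<open>
  Write \<open>e\<^sub>k\<close> for the element of \<open>E\<close> attached to \<open>k \<in> K\<close>. The key to the brace structure on \<open>K\<close> is
  that its multiplication \<open>k \<boxdot> l\<close> is the group operation of \<open>H\<close>, transported along
  \<open>k \<mapsto> k e\<^sub>k\<close>: since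
  \<open>(k \<boxdot> l) (e\<^sub>k e\<^sub>l) = (k e\<^sub>k) (l e\<^sub>l)\<close> lies in \<open>H\<close>, the element attached to \<open>k \<boxdot> l\<close> is \<open>e\<^sub>k e\<^sub>l\<close>.
  So \<open>k \<mapsto> e\<^sub>k\<close> is multiplicative, \<open>\<boxdot>\<close> is a group operation, and \<open>k \<boxdot> l\<close> is \<open>k\<close> times the image of
  \<open>l\<close> under a conjugation; conjugation respects the operation of \<open>G\<close>, which is the brace law.

  The operations of the brace are built from the group operation and from \<open>e\<^sub>k\<close>, which is characterised
  uniquely by \<open>e\<^sub>k \<in> E\<close> and \<open>k e\<^sub>k \<in> H\<close>. A morphism \<open>f\<close> preserves both conditions, so
  it maps \<open>e\<^sub>k\<close> to the element attached to \<open>f k\<close>, and hence preserves both operations.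
\<close>

lemma (in group) mult_inv_cancel_left:
  assumes "x \<in> carrier G" "y \<in> carrier G"
  shows "x \<otimes> (inv x \<otimes> y) = y" "inv x \<otimes> (x \<otimes> y) = y"
  using assms by (simp_all flip: m_assoc)

context trifactorised_group
begin

text \<open>
  Existence is \<open>G = HE\<close>: if \<open>k = h e\<close> then \<open>k e\<inverse> = h \<in> H\<close>. Uniqueness is \<open>H \<inter> E = 1\<close>: two candidates
  \<open>d, e\<close> differ by \<open>d\<inverse> e = (k d)\<inverse> (k e) \<in> H \<inter> E\<close>.
\<close>

lemma ex1_brace_elt:
  assumes k: "k \<in> carrier G"
  shows "\<exists>!e. e \<in> E \<and> k \<otimes> e \<in> H"
proof (rule ex_ex1I)
  from k factor_HE obtain h e where he: "h \<in> H" "e \<in> E" "k = h \<otimes> e"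
    unfolding set_mult_def by blast
  then have "k \<otimes> inv e = h" by (simp add: m_assoc)
  with he show "\<exists>e. e \<in> E \<and> k \<otimes> e \<in> H"
    by (intro exI[of _ "inv e"]) simp
next
  fix d e
  assume d: "d \<in> E \<and> k \<otimes> d \<in> H" and e: "e \<in> E \<and> k \<otimes> e \<in> H"
  then have "inv (k \<otimes> d) \<otimes> (k \<otimes> e) \<in> H" by blast
  moreover have "inv (k \<otimes> d) \<otimes> (k \<otimes> e) = inv d \<otimes> e"
    using k d e by (simp add: inv_mult_group m_assoc mult_inv_cancel_left)
  moreover have "inv d \<otimes> e \<in> E" using d e by blast
  ultimately have "inv d \<otimes> e = \<one>" using H_inter_E by auto
  then have "d \<otimes> (inv d \<otimes> e) = d" using d by simp
  then show "d = e" using d e by (simp add: mult_inv_cancel_left)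
qed

lemma
  assumes "k \<in> carrier G"
  shows brace_elt_in: "brace_elt G H E k \<in> E"
    and mult_brace_elt_in: "k \<otimes> brace_elt G H E k \<in> H"
  using theI'[OF ex1_brace_elt[OF assms]] unfolding brace_elt_def by auto

lemma brace_elt_carrier [simp]:
  assumes "k \<in> carrier G"
  shows "brace_elt G H E k \<in> carrier G"
  using brace_elt_in[OF assms] by simp

lemma brace_elt_eqI:
  assumes "k \<in> carrier G" "e \<in> E" "k \<otimes> e \<in> H"
  shows "brace_elt G H E k = e"
  unfolding brace_elt_def using ex1_brace_elt[OF assms(1)] assms(2,3) by (intro the1_equality) auto

definition brace_mult :: "'a \<Rightarrow> 'a \<Rightarrow> 'a"
  where "brace_mult k l = k \<otimes> (brace_elt G H E k \<otimes> l \<otimes> inv (brace_elt G H E k))"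

lemma brace_mult_carrier [simp]:
  assumes "k \<in> carrier G" "l \<in> carrier G"
  shows "brace_mult k l \<in> carrier G"
  using assms by (simp add: brace_mult_def)

text \<open>Normality of \<open>K\<close> is what keeps the conjugate of \<open>l\<close> inside \<open>K\<close>.\<close>

lemma brace_mult_in_K:
  assumes "k \<in> K" "l \<in> K"
  shows "brace_mult k l \<in> K"
  using assms by (simp add: brace_mult_def K.inv_op_closed2)

text \<open>
  In \<open>(k \<boxdot> l) e\<^sub>k e\<^sub>l\<close> the trailing factor \<open>e\<^sub>k\<inverse>\<close> of the conjugate cancels, leaving the product of
  \<open>k e\<^sub>k\<close> and \<open>l e\<^sub>l\<close> in \<open>H\<close>.
\<close>

lemma brace_elt_brace_mult:
  assumes k: "k \<in> carrier G" and l: "l \<in> carrier G"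
  shows "brace_elt G H E (brace_mult k l) = brace_elt G H E k \<otimes> brace_elt G H E l"
proof (rule brace_elt_eqI)
  have "brace_mult k l \<otimes> (brace_elt G H E k \<otimes> brace_elt G H E l)
      = (k \<otimes> brace_elt G H E k) \<otimes> (l \<otimes> brace_elt G H E l)"
    using k l by (simp add: brace_mult_def m_assoc mult_inv_cancel_left)
  then show "brace_mult k l \<otimes> (brace_elt G H E k \<otimes> brace_elt G H E l) \<in> H"
    using mult_brace_elt_in[OF k] mult_brace_elt_in[OF l] by simp
qed (use k l brace_elt_in in simp_all)

lemma brace_mult_assoc:
  assumes "k \<in> carrier G" "l \<in> carrier G" "m \<in> carrier G"
  shows "brace_mult (brace_mult k l) m = brace_mult k (brace_mult l m)"
proof -
  have "brace_mult (brace_mult k l) m = brace_mult k l \<otimes>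
      (brace_elt G H E k \<otimes> brace_elt G H E l \<otimes> m \<otimes>
        inv (brace_elt G H E k \<otimes> brace_elt G H E l))"
    using assms by (simp add: brace_mult_def[of "brace_mult k l"] brace_elt_brace_mult)
  also have "\<dots> = brace_mult k (brace_mult l m)"
    using assms by (simp add: brace_mult_def inv_mult_group m_assoc mult_inv_cancel_left)
  finally show ?thesis .
qed

lemma brace_mult_one_left:
  assumes "k \<in> carrier G"
  shows "brace_mult \<one> k = k"
proof -
  have "brace_elt G H E \<one> = \<one>" by (rule brace_elt_eqI) simp_all
  then show ?thesis using assms by (simp add: brace_mult_def)
qed

text \<open>
  The inverse of \<open>k\<close> corresponds to \<open>(k e\<^sub>k)\<inverse> = e\<^sub>k\<inverse> k\<inverse> = (e\<^sub>k\<inverse> k\<inverse> e\<^sub>k) e\<^sub>k\<inverse>\<close> in \<open>H\<close>, so it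
  is the conjugate \<open>e\<^sub>k\<inverse> k\<inverse> e\<^sub>k\<close>, with attached element \<open>e\<^sub>k\<inverse>\<close>.
\<close>

lemma ex_brace_mult_inverse:
  assumes k: "k \<in> K"
  shows "\<exists>l\<in>K. brace_mult l k = \<one>"
proof
  define e where "e = brace_elt G H E k"
  define l where "l = inv e \<otimes> inv k \<otimes> e"
  have kG: "k \<in> carrier G" using k by simp
  have e: "e \<in> E" "e \<in> carrier G" and ke: "k \<otimes> e \<in> H"
    using brace_elt_in[OF kG] mult_brace_elt_in[OF kG] by (simp_all add: e_def)
  show lK: "l \<in> K" unfolding l_def using k e by (simp add: K.inv_op_closed1)
  have "l \<otimes> inv e = inv (k \<otimes> e)"
    using kG e by (simp add: l_def inv_mult_group m_assoc)
  then have "brace_elt G H E l = inv e"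
    using lK e ke by (intro brace_elt_eqI) simp_all
  then show "brace_mult l k = \<one>"
    using kG e by (simp add: brace_mult_def l_def m_assoc mult_inv_cancel_left)
qed

lemma group_brace_mult:
  "group \<lparr>carrier = K, monoid.mult = brace_mult, one = \<one>\<rparr>"
  by (rule groupI)
    (simp_all add: brace_mult_in_K brace_mult_assoc brace_mult_one_left ex_brace_mult_inverse)

lemma brace_mult_distrib:
  assumes "k \<in> carrier G" "l \<in> carrier G" "m \<in> carrier G"
  shows "brace_mult k (l \<otimes> m) = brace_mult k l \<otimes> inv k \<otimes> brace_mult k m"
  using assms by (simp add: brace_mult_def m_assoc mult_inv_cancel_left)

lemma associated_brace_eq:
  "associated_brace G K H E =
    \<lparr>carrier = K, monoid.mult = brace_mult, one = \<one>, ring.zero = \<one>, ring.add = (\<otimes>)\<rparr>"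
  by (simp add: associated_brace_def brace_mult_def[abs_def])

lemma add_monoid_associated_brace:
  "add_monoid (associated_brace G K H E) = \<lparr>carrier = K, monoid.mult = (\<otimes>), one = \<one>\<rparr>"
  by (simp add: associated_brace_eq)

lemma group_additive: "group \<lparr>carrier = K, monoid.mult = (\<otimes>), one = \<one>\<rparr>"
proof (rule groupI)
  fix k assume "k \<in> carrier \<lparr>carrier = K, monoid.mult = (\<otimes>), one = \<one>\<rparr>"
  then have "inv k \<in> K" "inv k \<otimes> k = \<one>" by simp_all
  then show "\<exists>l\<in>carrier \<lparr>carrier = K, monoid.mult = (\<otimes>), one = \<one>\<rparr>.
      l \<otimes>\<^bsub>\<lparr>carrier = K, monoid.mult = (\<otimes>), one = \<one>\<rparr>\<^esub> k
        = \<one>\<^bsub>\<lparr>carrier = K, monoid.mult = (\<otimes>), one = \<one>\<rparr>\<^esub>"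
    by auto
qed (simp_all add: m_assoc)

lemma a_inv_associated_brace:
  assumes "k \<in> K"
  shows "\<ominus>\<^bsub>associated_brace G K H E\<^esub> k = inv k"
  unfolding a_inv_def add_monoid_associated_brace
  by (rule group.inv_equality[OF group_additive]) (use assms in simp_all)

lemma skew_left_brace_associated_brace: "skew_left_brace (associated_brace G K H E)"
proof (rule skew_left_brace.intro)
  show "group (add_monoid (associated_brace G K H E))"
    unfolding add_monoid_associated_brace by (rule group_additive)
  \<comment> \<open>Being a group depends only on the carrier, the multiplication and the unit, so the
    additional ring fields can be dropped.\<close>
  show "group (associated_brace G K H E)"
    using group_brace_mult
    by (simp add: associated_brace_eq group_def group_axioms_def monoid_def Units_def)
next
  fix a b c
  assume "a \<in> carrier (associated_brace G K H E)" "b \<in> carrier (associated_brace G K H E)"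
    "c \<in> carrier (associated_brace G K H E)"
  then have K: "a \<in> K" "b \<in> K" "c \<in> K" by (simp_all add: associated_brace_eq)
  have "a \<otimes>\<^bsub>associated_brace G K H E\<^esub> b \<ominus>\<^bsub>associated_brace G K H E\<^esub> a
      = brace_mult a b \<otimes> inv a"
    unfolding a_minus_def a_inv_associated_brace[OF K(1)] by (simp add: associated_brace_eq)
  then show "a \<otimes>\<^bsub>associated_brace G K H E\<^esub> (b \<oplus>\<^bsub>associated_brace G K H E\<^esub> c)
      = (a \<otimes>\<^bsub>associated_brace G K H E\<^esub> b \<ominus>\<^bsub>associated_brace G K H E\<^esub> a)
        \<oplus>\<^bsub>associated_brace G K H E\<^esub> (a \<otimes>\<^bsub>associated_brace G K H E\<^esub> c)"
    using K by (simp add: associated_brace_eq brace_mult_distrib)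
qed

end

context trifactorised_group_hom
begin

sublocale group_hom G1 G2 f
  by unfold_locales (rule hom)

text \<open>\<open>f e\<^sub>k\<close> satisfies the two conditions that determine the element attached to \<open>f k\<close>.\<close>

lemma hom_brace_elt:
  assumes k: "k \<in> carrier G1"
  shows "f (brace_elt G1 H1 E1 k) = brace_elt G2 H2 E2 (f k)"
proof (rule target.brace_elt_eqI[symmetric])
  show "f (brace_elt G1 H1 E1 k) \<in> E2"
    using source.brace_elt_in[OF k] image_E by blast
  have "f (k \<otimes>\<^bsub>G1\<^esub> brace_elt G1 H1 E1 k) \<in> H2"
    using source.mult_brace_elt_in[OF k] image_H by blast
  then show "f k \<otimes>\<^bsub>G2\<^esub> f (brace_elt G1 H1 E1 k) \<in> H2"
    using k by simp
qed (use k in simp)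

lemma hom_brace_mult:
  assumes "k \<in> carrier G1" "l \<in> carrier G1"
  shows "f (source.brace_mult k l) = target.brace_mult (f k) (f l)"
  using assms by (simp add: source.brace_mult_def target.brace_mult_def hom_brace_elt)

end

theorem proposition3p9:
  fixes G1 :: "('a, 'm) monoid_scheme" and G2 :: "('b, 'n) monoid_scheme"
    and K1 H1 E1 :: "'a set" and K2 H2 E2 :: "'b set"
    and f :: "'a \<Rightarrow> 'b"
  assumes "trifactorised_group_hom G1 K1 H1 E1 G2 K2 H2 E2 f"
  shows "skew_left_brace_hom (associated_brace G1 K1 H1 E1) (associated_brace G2 K2 H2 E2)
    (restrict f K1)"
proof -
  interpret trifactorised_group_hom G1 K1 H1 E1 G2 K2 H2 E2 f by (rule assms)
  show ?thesis
    unfolding skew_left_brace_hom_def skew_left_brace_hom_axioms_def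
    using source.skew_left_brace_associated_brace target.skew_left_brace_associated_brace image_K
    by (auto simp: source.associated_brace_eq target.associated_brace_eq hom_brace_mult
        source.brace_mult_in_K)
qed

end
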